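(* For every positive integer $m$, \begin{align*} \zeta^\star(2,\{1\}_m,\bar 1)=&\frac{m+2}{(m+3)!}(-1)^m\ln^{m+3}(2)+(m+2)(-1)^m\left(\zeta(m+3)-\mathrm{Li}_{m+3}\!\left(\tfrac12\right)\right)\\ &-(m+2)(-1)^m\sum_{j=1}^{m+2}\frac{\ln^{m+3-j}(2)}{(m+3-j)!}\mathrm{Li}_j\!\left(\tfrac12\right)-\frac32\frac{(-1)^m}{(m+1)!}\zeta(2)\ln^{m+1}(2)\\ &-\frac{(-1)^m}{(m+1)!}\sum_{i=1}^{m}(-1)^{i-1}\, i!\binom{m+1}{i}\ln^{m+1-i}(2)\Big\{\zeta^\star(2,\{1\}_{i-1},\bar 1)-\zeta^\star(2,\{1\}_i)\Big\}, \end{align*} where $\zeta^\star(2,\bar 1)=\frac14\zeta(3)-\frac32\zeta(2)\ln(2)$.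
   Context: For nonzero integers $s_1,\dots,s_k$, with $\operatorname{sgn}(s)=1$ if $s>0$ and $-1$ if $s<0$, the multiple zeta star value is $\zeta^\star(s_1,\dots,s_k)=\sum_{n_1\ge n_2\ge\cdots\ge n_k\ge 1}\prod_{j=1}^k n_j^{-|s_j|}\operatorname{sgn}(s_j)^{n_j}$. A barred entry $\bar p$ denotes the negative entry $-p$. The notation $\{1\}_d$ means the entry $1$ repeated $d$ times ($d=0$ means no entries). $\zeta(s)=\sum_{n\ge1}n^{-s}$ is the Riemann zeta function and $\mathrm{Li}_s(x)=\sum_{n\ge1}x^n/n^s$ is the polylogarithm. *)

theory Defs
  imports "HOL-Analysis.Analysis"
begin

fun mzs_trunc :: "int list \<Rightarrow> nat \<Rightarrow> real" where
  "mzs_trunc [] N = 1"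
| "mzs_trunc (s # ss) N =
     (\<Sum>n=1..N. (if s > 0 then 1 else -1) ^ n / real n ^ nat \<bar>s\<bar> * mzs_trunc ss n)"

definition zeta_star :: "int list \<Rightarrow> real" where
  "zeta_star ss = lim (\<lambda>N. mzs_trunc ss N)"

definition rzeta :: "nat \<Rightarrow> real" where
  "rzeta s = (\<Sum>n. 1 / real (Suc n) ^ s)"

definition polylog :: "nat \<Rightarrow> real \<Rightarrow> real" where
  "polylog s x = (\<Sum>n. x ^ Suc n / real (Suc n) ^ s)"

end

theory Submission
  imports Defs
begin

text \<open>
  Integrating \<open>u\<^bsup>n-1\<^esup> ln\<^bsup>p\<^esup> (1 + u)\<close> over \<open>[0, 1]\<close> by parts expresses it through the
  same integrals with exponent \<open>p - 1\<close> and indices \<open>k \<le> n\<close>; unrolled, this is a combination of truncated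
  star sums with entries \<open>1\<close> and one final \<open>-1\<close>. Multiplying by \<open>(-1)\<^bsup>n\<^esup> / n\<close> and summing over
  \<open>n\<close> turns the integrals into \<open>- \<integral> ln\<^bsup>p+1\<^esup> (1 + u) / u du\<close>, and the star sums into the
  zeta star values with leading entry \<open>2\<close>. For \<open>p = m + 1\<close> this gives the recursion, because the
  remaining integral is elementary: with \<open>v = 1 / (1 + u)\<close>, repeated integration by parts
  produces the polylogarithms at \<open>1/2\<close>.
\<close>

subsection \<open>Polylogarithms with logarithmic weights\<close>

text \<open>For \<open>x\<close> at least 0, a single term of the exponential series is at most the
  whole sum.\<close>

lemma power_le_fact_mult_exp:
  fixes x :: real
  assumes "0 \<le> x"
  shows "x ^ k \<le> fact k * exp x"
proof -
  have "(\<Sum>i\<in>{k}. x ^ i /\<^sub>R fact i) \<le> exp x"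
    using exp_converges[of x] assms
    by (simp only: sums_iff) (metis (no_types, lifting) finite.emptyI finite.insertI scaleR_nonneg_nonneg
        sum_le_suminf inverse_nonnegative_iff_nonnegative fact_ge_zero zero_le_power)
  then show ?thesis
    by (simp add: field_simps)
qed

text \<open>Substituting \<open>x = - (n + 1) ln v\<close> reduces this to
  \<open>x^k exp (- x) <= k!\<close>. The bound is uniform in \<open>v\<close>: every logarithm
  gains a factor \<open>1 / (n + 1)\<close>.\<close>

lemma power_mult_ln_power_le:
  fixes v :: real
  assumes "0 \<le> v" "v \<le> 1"
  shows "(- ln v) ^ k / fact k * v ^ Suc n \<le> 1 / real (Suc n) ^ k"
proof (cases "v = 0")
  case False
  define x where "x = real (Suc n) * - ln v"
  have "0 \<le> x"
    using assms False by (auto simp: x_def mult_nonneg_nonpos)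
  have "v ^ Suc n = exp (- x)"
    using assms False by (simp add: x_def flip: ln_realpow) (simp add: exp_of_nat_mult flip: of_nat_Suc exp_add)
  moreover have "x ^ k \<le> fact k * exp x"
    using \<open>0 \<le> x\<close> by (rule power_le_fact_mult_exp)
  then have "x ^ k / fact k * exp (- x) \<le> 1"
    by (simp add: exp_minus field_simps)
  moreover have "x ^ k = real (Suc n) ^ k * (- ln v) ^ k"
    by (simp only: x_def power_mult_distrib)
  ultimately show ?thesis
    by (simp add: field_simps del: of_nat_Suc power_Suc)
qed auto

lemma continuous_on_power_mult_ln_power:
  "continuous_on {0..1} (\<lambda>v::real. (- ln v) ^ k * v ^ Suc n)"
proof -
  \<comment> \<open>The only critical point is 0, where the function has the value 0; one factor
    \<open>v\<close> already beats every power of \<open>ln v\<close>.\<close>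
  have "((\<lambda>v::real. (- ln v) ^ k * v) \<longlongrightarrow> 0) (at_right 0)"
  proof -
    have "filterlim (\<lambda>v::real. - ln v) at_top (at_right 0)"
      using ln_at_0 by (simp add: filterlim_uminus_at_bot)
    then have "((\<lambda>v::real. (- ln v) ^ k / exp (- ln v)) \<longlongrightarrow> 0) (at_right 0)"
      by (rule filterlim_compose[OF tendsto_power_div_exp_0])
    then show ?thesis
      by (rule Lim_transform_eventually)
        (auto simp: eventually_at_filter exp_minus divide_inverse intro!: always_eventually)
  qed
  then have "((\<lambda>v::real. (- ln v) ^ k * v * v ^ n) \<longlongrightarrow> 0 * 0 ^ n) (at_right 0)"
    by (intro tendsto_intros)
  then have "((\<lambda>v::real. (- ln v) ^ k * v ^ Suc n) \<longlongrightarrow> 0) (at 0 within {0..1})"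
    by (auto simp: at_within_Icc_at_right mult_ac)
  then have "continuous (at 0 within {0..1}) (\<lambda>v::real. (- ln v) ^ k * v ^ Suc n)"
    by (simp add: continuous_within)
  moreover have "continuous (at v within {0..1}) (\<lambda>v::real. (- ln v) ^ k * v ^ Suc n)" if "v > 0" for v
    using that by (intro continuous_intros) auto
  ultimately show ?thesis
    unfolding continuous_on_eq_continuous_within by (force simp: le_less)
qed

lemma summable_inverse_Suc_power:
  assumes "2 \<le> p"
  shows "summable (\<lambda>n. 1 / real (Suc n) ^ p)"
  using inverse_power_summable[OF assms, where 'a = real]
  by (subst (asm) summable_Suc_iff[symmetric]) (simp add: inverse_eq_divide)

lemma summable_polylog:
  fixes x :: real
  assumes "\<bar>x\<bar> < 1"
  shows "summable (\<lambda>n. x ^ Suc n / real (Suc n) ^ j)"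
proof (rule summable_comparison_test')
  show "summable (\<lambda>n. \<bar>x\<bar> ^ Suc n)"
    using assms by (subst summable_Suc_iff) (simp add: summable_geometric)
  show "norm (x ^ Suc n / real (Suc n) ^ j) \<le> \<bar>x\<bar> ^ Suc n" for n
    using one_le_power[of "real (Suc n)" j]
    by (simp add: power_abs divide_le_eq mult_le_cancel_left1 abs_mult del: of_nat_Suc power_Suc)
qed

lemma polylog_zero_left:
  assumes "\<bar>x\<bar> < 1"
  shows "polylog 0 x = x / (1 - x)"
  using suminf_mult[OF summable_geometric, of x x] suminf_geometric[of x] assms
  by (simp add: polylog_def)

lemma polylog_zero_right [simp]: "polylog j 0 = 0"
  by (simp add: polylog_def)

lemma polylog_one_right: "polylog j 1 = rzeta j"
  by (simp add: polylog_def rzeta_def)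

lemma polylog_has_real_derivative:
  assumes "\<bar>x\<bar> < 1" "x \<noteq> 0"
  shows "(polylog (Suc j) has_real_derivative polylog j x / x) (at x)"
proof -
  have eq: "1 / real (Suc n) ^ Suc j * real (Suc n) * y ^ n = y ^ n / real (Suc n) ^ j" for n y
    by simp
  have s: "summable (\<lambda>n. y ^ n / real (Suc n) ^ j)" if "\<bar>y\<bar> < 1" for y :: real
  proof (cases "y = 0")
    case True
    then show ?thesis by (intro summable_finite[of "{0}"]) auto
  next
    case False
    have "summable (\<lambda>n. inverse y * (y ^ Suc n / real (Suc n) ^ j))"
      by (intro summable_mult summable_polylog that)
    then show ?thesis using False by (simp add: field_simps)
  qed
  have "((\<lambda>x. \<Sum>n. 1 / real (Suc n) ^ Suc j * x ^ Suc n) has_real_derivative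
      (\<Sum>n. 1 / real (Suc n) ^ Suc j * real (Suc n) * x ^ n)) (at x)"
    by (rule DERIV_power_series'[of 1]) (use assms s in \<open>auto simp only: eq\<close>, auto)
  moreover have "(\<Sum>n. x ^ n / real (Suc n) ^ j) = polylog j x / x"
    unfolding polylog_def using assms by (subst suminf_divide[symmetric, OF summable_polylog]) auto
  ultimately show ?thesis
    unfolding eq by (simp add: polylog_def[abs_def])
qed

text \<open>The Weierstrass test on the closed interval, with majorant
  \<open>1 / (n + 1)^(k + j)\<close>, handles both critical endpoints at once: the logarithm at 0
  and the boundary of the disc of convergence at \<open>v = 1\<close>.\<close>

lemma continuous_on_ln_power_mult_polylog:
  assumes "\<bar>s\<bar> \<le> 1" "2 \<le> k + j"
  shows "continuous_on {0..1} (\<lambda>v. (- ln v) ^ k / fact k * polylog j (s * v))"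
proof -
  define f where "f = (\<lambda>n v. (- ln v) ^ k / fact k * ((s * v) ^ Suc n / real (Suc n) ^ j))"
  have "norm (f n v) \<le> 1 / real (Suc n) ^ (k + j)" if "v \<in> {0..1}" for n v
  proof -
    define w where "w = (- ln v) ^ k / fact k * v ^ Suc n"
    have "0 \<le> - ln v"
      using that by (cases "v = 0") auto
    then have "0 \<le> w"
      using that by (auto simp: w_def)
    have "\<bar>s\<bar> ^ Suc n * w \<le> 1 * (1 / real (Suc n) ^ k)"
      unfolding w_def using that assms(1) \<open>0 \<le> w\<close>[unfolded w_def]
      by (intro mult_mono power_mult_ln_power_le power_le_one) auto
    moreover have "f n v = s ^ Suc n * w / real (Suc n) ^ j"
      unfolding f_def w_def power_mult_distrib by (simp add: mult_ac del: of_nat_Suc power_Suc)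
    then have "norm (f n v) = \<bar>s\<bar> ^ Suc n * w / real (Suc n) ^ j"
      using \<open>0 \<le> w\<close> by (simp add: abs_mult power_abs del: of_nat_Suc power_Suc)
    ultimately show ?thesis
      by (simp add: power_add divide_right_mono flip: divide_divide_eq_left del: of_nat_Suc power_Suc)
  qed
  then have "uniformly_convergent_on {0..1} (\<lambda>n v. \<Sum>i<n. f i v)"
    by (rule Weierstrass_m_test') (use summable_inverse_Suc_power[OF assms(2)] in auto)
  then have "uniform_limit {0..1} (\<lambda>n v. \<Sum>i<n. f i v) (\<lambda>v. \<Sum>i. f i v) sequentially"
    by (rule uniform_limit_suminf)
  moreover have "continuous_on {0..1} (\<lambda>v. \<Sum>i<n. f i v)" for n
  proof -
    have "continuous_on {0..1} (\<lambda>v. s ^ Suc i / (fact k * real (Suc i) ^ j) * ((- ln v) ^ k * v ^ Suc i))" for i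
      by (intro continuous_intros continuous_on_power_mult_ln_power)
    then show ?thesis
      by (intro continuous_on_sum) (simp add: f_def power_mult_distrib mult_ac)
  qed
  ultimately have "continuous_on {0..1} (\<lambda>v. \<Sum>i. f i v)"
    by (intro uniform_limit_theorem[OF always_eventually]) auto
  moreover have "(\<Sum>i. f i v) = (- ln v) ^ k / fact k * polylog j (s * v)" if "v \<in> {0..1}" for v
  \<comment> \<open>At \<open>v = 1\<close> with \<open>k > 0\<close> both sides vanish because
    \<open>ln 1 = 0\<close>, whatever value a divergent series receives. In all other cases the
    polylogarithm series converges.\<close>
  proof (cases "v = 1 \<and> k > 0")
    case False
    have "summable (\<lambda>n. (s * v) ^ Suc n / real (Suc n) ^ j)"
    proof (cases "v = 1")
      case True
      then have "summable (\<lambda>n. 1 / real (Suc n) ^ j)"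
        using False assms by (intro summable_inverse_Suc_power) auto
      moreover have "norm ((s * v) ^ Suc n / real (Suc n) ^ j) \<le> 1 / real (Suc n) ^ j" for n
        using assms(1) True power_le_one[of "\<bar>s\<bar>" "Suc n"]
        by (simp add: power_abs divide_right_mono abs_mult del: of_nat_Suc power_Suc)
      ultimately show ?thesis
        by (rule summable_comparison_test')
    next
      case False
      have "\<bar>s\<bar> * \<bar>v\<bar> \<le> 1 * \<bar>v\<bar>"
        using assms(1) by (intro mult_right_mono) auto
      then show ?thesis
        using that False by (intro summable_polylog) (auto simp: abs_mult)
    qed
    then show ?thesis
      unfolding f_def polylog_def by (rule suminf_mult)
  qed (auto simp: f_def zero_power)
  ultimately show ?thesis
    by (rule continuous_on_eq)
qed

subsection \<open>The integral of a power of ln (1 + u) divided by u\<close>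

text \<open>
  An antiderivative of \<open>s (- ln v)\<^bsup>p\<^esup> / (p! (1 - s v))\<close>. The junk values \<open>ln 0 = 0\<close> and
  \<open>polylog 1 1\<close> (a divergent series, weighted with \<open>(ln 1)\<^bsup>p\<^esup> = 0\<close>) agree with the
  one-sided limits, so that for \<open>p \<ge> 1\<close> the function is continuous on all of \<open>[0, 1]\<close>.
\<close>
definition polylog_primitive :: "nat \<Rightarrow> real \<Rightarrow> real \<Rightarrow> real" where
  "polylog_primitive p s v =
     (\<Sum>j=1..p+1. (- ln v) ^ (p + 1 - j) / fact (p + 1 - j) * polylog j (s * v))"

lemma polylog_primitive_zero [simp]: "polylog_primitive p s 0 = 0"
  by (simp add: polylog_primitive_def)

lemma polylog_primitive_one: "polylog_primitive p s 1 = polylog (p + 1) s"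
proof -
  have "polylog_primitive p s 1 = (\<Sum>j=1..p+1. if j = p + 1 then polylog j s else 0)"
    unfolding polylog_primitive_def by (intro sum.cong) (auto simp: zero_power)
  then show ?thesis
    by simp
qed

lemma continuous_on_polylog_primitive:
  assumes "1 \<le> p" "\<bar>s\<bar> \<le> 1"
  shows "continuous_on {0..1} (polylog_primitive p s)"
  unfolding polylog_primitive_def[abs_def]
  by (intro continuous_on_sum continuous_on_ln_power_mult_polylog) (use assms in auto)

text \<open>Differentiation lowers either the power of the logarithm or the order of the
  polylogarithm, so each summand has a derivative \<open>h i - h (Suc i)\<close>. The sum telescopes
  to \<open>h 0\<close>, where \<open>polylog 0\<close> is rational.\<close>

lemma polylog_primitive_has_real_derivative:
  assumes "0 < v" "v < 1" "\<bar>s\<bar> = 1"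
  shows "(polylog_primitive p s has_real_derivative s * (- ln v) ^ p / fact p / (1 - s * v)) (at v)"
proof -
  \<comment> \<open>The cut-off after \<open>p\<close> reflects that the last summand has no
    logarithm left to differentiate.\<close>
  define h where "h j = (if j \<le> p then (- ln v) ^ (p - j) / fact (p - j) * polylog j (s * v) / v else 0)" for j
  have sv: "\<bar>s * v\<bar> < 1" "s * v \<noteq> 0" "s \<noteq> 0"
    using assms by (auto simp: abs_mult)
  have *: "((\<lambda>v. (- ln v) ^ (p - i) / fact (p - i) * polylog (Suc i) (s * v)) has_real_derivative
      h i - h (Suc i)) (at v)" if "i < Suc p" for i
  proof -
    have P: "((\<lambda>v. polylog (Suc i) (s * v)) has_real_derivative polylog i (s * v) / (s * v) * s) (at v)"
      by (rule DERIV_chain2[where g = "\<lambda>v. s * v" and x = v, OF polylog_has_real_derivative[OF sv(1,2)]])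
        (auto intro!: derivative_eq_intros)
    show ?thesis
    proof (cases "p - i")
      case 0
      with that have "i = p" by simp
      with P sv assms(1) show ?thesis
        by (simp add: h_def)
    next
      case (Suc k)
      then have k: "p - Suc i = k" "i \<le> p" "Suc i \<le> p"
        by auto
      have Q: "((\<lambda>v. (- ln v) ^ Suc k / fact (Suc k)) has_real_derivative - ((- ln v) ^ k / fact k / v)) (at v)"
      proof -
        have "((\<lambda>v. - ln v) has_real_derivative - (1 / v)) (at v)"
          using assms(1) by (auto intro!: derivative_eq_intros)
        from DERIV_cdivide[OF DERIV_power[OF this, of "Suc k"], of "fact (Suc k)"] show ?thesis
          by (simp add: mult_ac del: of_nat_Suc power_Suc)
      qed
      show ?thesis
        unfolding Suc by (rule DERIV_cong[OF DERIV_mult[OF Q P]])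
          (use sv assms(1) in \<open>simp add: h_def k Suc mult_ac\<close>)
    qed
  qed
  have "((\<lambda>v. \<Sum>i<Suc p. (- ln v) ^ (p - i) / fact (p - i) * polylog (Suc i) (s * v))
      has_real_derivative (\<Sum>i<Suc p. h i - h (Suc i))) (at v)"
    by (rule DERIV_sum) (use * in auto)
  also have "(\<Sum>i<Suc p. h i - h (Suc i)) = h 0 - h (Suc p)"
    by (rule sum_lessThan_telescope')
  also have "\<dots> = s * (- ln v) ^ p / fact p / (1 - s * v)"
    using assms(1) sv by (simp add: h_def polylog_zero_left)
  also have "(\<lambda>v. \<Sum>i<Suc p. (- ln v) ^ (p - i) / fact (p - i) * polylog (Suc i) (s * v)) =
      polylog_primitive p s"
    unfolding polylog_primitive_def
    by (intro ext sum.reindex_bij_witness[of _ "\<lambda>j. j - 1" Suc]) auto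
  finally show ?thesis .
qed

text \<open>An antiderivative of \<open>ln (1 + u)^p / u\<close>. With
  \<open>v = 1 / (1 + u)\<close>, \<open>ln (1 + u) = - ln v\<close> and
  \<open>du / u = - dv / v - dv / (1 - v)\<close>; the two parts yield the two terms.\<close>

definition ln_power_primitive :: "nat \<Rightarrow> real \<Rightarrow> real" where
  "ln_power_primitive p u =
     ln (1 + u) ^ (p + 1) / (real p + 1) - fact p * polylog_primitive p 1 (1 / (1 + u))"

lemma continuous_on_ln_power_primitive:
  assumes "1 \<le> p"
  shows "continuous_on {0..1} (ln_power_primitive p)"
proof -
  have "continuous_on {0..1} (\<lambda>u::real. polylog_primitive p 1 (1 / (1 + u)))"
    by (rule continuous_on_compose2[OF continuous_on_polylog_primitive[OF assms, of 1]])
      (auto intro!: continuous_intros)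
  then show ?thesis
    unfolding ln_power_primitive_def[abs_def]
    by (intro continuous_intros) auto
qed

lemma ln_power_primitive_has_real_derivative:
  assumes "0 < u"
  shows "(ln_power_primitive p has_real_derivative ln (1 + u) ^ p / u) (at u)"
proof -
  define v where "v = 1 / (1 + u)"
  have v: "0 < v" "v < 1" "- ln v = ln (1 + u)"
    using assms by (auto simp: v_def ln_div)
  have "((\<lambda>u. 1 / (1 + u)) has_real_derivative - (v ^ 2)) (at u)"
    using assms by (auto intro!: derivative_eq_intros simp: v_def power2_eq_square field_simps)
  from DERIV_chain2[OF polylog_primitive_has_real_derivative[OF v(1,2), of 1 p, unfolded v_def] this]
  have P: "((\<lambda>u. polylog_primitive p 1 (1 / (1 + u))) has_real_derivative
      (- ln v) ^ p / fact p / (1 - v) * - (v ^ 2)) (at u)"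
    by (simp add: v_def)
  have L: "((\<lambda>u. ln (1 + u) ^ (p + 1) / (real p + 1)) has_real_derivative ln (1 + u) ^ p / (1 + u)) (at u)"
  proof -
    have "((\<lambda>u. ln (1 + u)) has_real_derivative 1 / (1 + u)) (at u)"
      using assms by (auto intro!: derivative_eq_intros)
    from DERIV_cdivide[OF DERIV_power[OF this, of "p + 1"], of "real p + 1"] show ?thesis
      by (simp add: add_ac)
  qed
  have "ln (1 + u) ^ p / (1 + u) - fact p * ((- ln v) ^ p / fact p / (1 - v) * - (v ^ 2)) =
      ln (1 + u) ^ p * (v + v ^ 2 / (1 - v))"
    unfolding v(3) by (simp add: v_def divide_inverse algebra_simps)
  also have "v + v ^ 2 / (1 - v) = 1 / u"
  proof -
    have "1 - v = u * v" "v * (1 + u) = 1"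
      using assms by (simp_all add: v_def field_simps)
    moreover have "v + v ^ 2 / (u * v) = v * (1 + u) / u"
      using assms v(1) by (simp add: power2_eq_square field_simps)
    ultimately show ?thesis by simp
  qed
  finally show ?thesis
    using DERIV_diff[OF L DERIV_cmult[OF P, of "fact p"]]
    unfolding ln_power_primitive_def[abs_def] by simp
qed

lemma has_integral_ln_power_over_primitive:
  assumes "1 \<le> p"
  shows "((\<lambda>u. ln (1 + u) ^ p / u) has_integral (ln_power_primitive p 1 - ln_power_primitive p 0)) {0..1}"
  by (rule fundamental_theorem_of_calculus_interior[OF _ continuous_on_ln_power_primitive[OF assms]])
    (auto intro!: ln_power_primitive_has_real_derivative
      simp flip: has_real_derivative_iff_has_vector_derivative)

lemma has_integral_ln_power_over:
  assumes "1 \<le> p"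
  shows "((\<lambda>u. ln (1 + u) ^ p / u) has_integral
    (ln 2 ^ (p + 1) / (real p + 1) + fact p * (rzeta (p + 1) - polylog_primitive p 1 (1 / 2)))) {0..1}"
  using has_integral_ln_power_over_primitive[OF assms]
  by (simp add: ln_power_primitive_def polylog_primitive_one polylog_one_right algebra_simps)

section \<open>Alternating zeta values and the integral of \<open>ln (1 + u)^2 / u\<close>\<close>

lemma sums_rzeta:
  assumes "2 \<le> s"
  shows "(\<lambda>n. 1 / real (Suc n) ^ s) sums rzeta s"
  unfolding rzeta_def using summable_inverse_Suc_power[OF assms] by (rule summable_sums)

text \<open>Twice the terms with even denominators minus the full zeta series. Since denominators
  are \<open>Suc n\<close>, the even ones sit at odd indices \<open>n\<close>; they sum to
  \<open>rzeta s / 2^s\<close>.\<close>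

lemma sums_alternating_zeta:
  assumes "2 \<le> s"
  shows "(\<lambda>n. (-1) ^ Suc n / real (Suc n) ^ s) sums ((2 / 2 ^ s - 1) * rzeta s)"
proof -
  have "(\<lambda>k. 2 / 2 ^ s * (1 / real (Suc k) ^ s)) sums (2 / 2 ^ s * rzeta s)"
    by (intro sums_mult sums_rzeta assms)
  from sums_diff[OF sums_if'[OF this] sums_rzeta[OF assms]]
  have "(\<lambda>n. (if even n then 0 else 2 / 2 ^ s * (1 / real (Suc ((n - 1) div 2)) ^ s)) - 1 / real (Suc n) ^ s)
      sums (2 / 2 ^ s * rzeta s - rzeta s)" .
  also have "(\<lambda>n. (if even n then 0 else 2 / 2 ^ s * (1 / real (Suc ((n - 1) div 2)) ^ s)) - 1 / real (Suc n) ^ s) =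
      (\<lambda>n. (-1) ^ Suc n / real (Suc n) ^ s)" (is "?f = ?g")
  proof
    fix n
    show "?f n = ?g n"
    proof (cases "even n")
      case False
      then obtain k where "n = 2 * k + 1"
        by (auto elim: oddE)
      moreover have "real (Suc (2 * k + 1)) ^ s = 2 ^ s * real (Suc k) ^ s"
        by (simp flip: power_mult_distrib)
      ultimately show ?thesis
        by (simp add: field_simps del: of_nat_Suc)
    qed simp
  qed
  finally show ?thesis
    by (simp add: algebra_simps)
qed

lemma polylog_minus_one:
  assumes "2 \<le> s"
  shows "polylog s (-1) = (2 / 2 ^ s - 1) * rzeta s"
  using sums_alternating_zeta[OF assms] by (simp add: polylog_def sums_iff)

text \<open>
  With \<open>a = ln (1 - u)\<close> and \<open>b = ln (1 + u)\<close>, integrate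
  \<open>2 a\<^sup>2 + 2 b\<^sup>2 = (a + b)\<^sup>2 + (a - b)\<^sup>2\<close> against \<open>du / u\<close>. The first square on the right is
  reduced to \<open>a\<close> by \<open>u \<mapsto> u\<^sup>2\<close>, the second one is rational in \<open>w = (1 - u) / (1 + u)\<close>.
\<close>
lemma has_integral_ln_square_over:
  "((\<lambda>u. ln (1 + u) ^ 2 / u) has_integral rzeta 3 / 4) {0..1}"
proof -
  define \<Phi> where "\<Phi> = polylog_primitive 2"
  \<comment> \<open>Each term integrates a multiple of one square over \<open>u\<close>; the last
    two do so only jointly, as \<open>1 / (u (1 + u)) + 1 / (1 + u) = 1 / u\<close>. The
    coefficients make the derivative of \<open>F\<close> vanish.\<close>
  define F where "F = (\<lambda>u. - 4 * \<Phi> 1 (1 - u) + 2 * ln_power_primitive 2 u + \<Phi> 1 (1 - u ^ 2)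
    + 2 * \<Phi> 1 ((1 - u) / (1 + u)) - 2 * \<Phi> (-1) ((1 - u) / (1 + u)))"
  have \<Phi>: "continuous_on {0..1} (\<lambda>u. \<Phi> s (g u))"
    if "continuous_on {0..1} g" "g ` {0..1} \<subseteq> {0..1}" "\<bar>s\<bar> \<le> 1" for s and g :: "real \<Rightarrow> real"
    unfolding \<Phi>_def
    by (rule continuous_on_compose2[OF continuous_on_polylog_primitive that(1,2)]) (use that in auto)
  have "F 1 = F 0"
  proof (rule DERIV_isconst_end[where f = F])
    show "continuous_on {0..1} F"
      unfolding F_def
      by (intro continuous_intros \<Phi> continuous_on_ln_power_primitive)
        (auto simp: power_le_one)
    fix u :: real
    assume u: "0 < u" "u < 1"
    define w where "w = (1 - u) / (1 + u)"
    have w: "0 < w" "w < 1"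
      using u by (auto simp: w_def)
    have sq: "0 < 1 - u ^ 2" "1 - u ^ 2 < 1"
      using u by (auto simp: power_less_one_iff)
    have D: "((\<lambda>u. \<Phi> s (g u)) has_real_derivative s * ln (g u) ^ 2 / 2 / (1 - s * g u) * g') (at u)"
      if "(g has_real_derivative g') (at u)" "0 < g u" "g u < 1" "\<bar>s\<bar> = 1" for s g g'
      using DERIV_chain2[OF polylog_primitive_has_real_derivative[OF that(2,3,4), of 2] that(1)]
      by (simp add: \<Phi>_def)
    have dw: "((\<lambda>u. (1 - u) / (1 + u)) has_real_derivative - 2 / (1 + u) ^ 2) (at u)"
      using u by (auto intro!: derivative_eq_intros simp: power2_eq_square field_simps)
    have d1: "((\<lambda>u. 1 - u) has_real_derivative -1) (at u)"
      by (auto intro!: derivative_eq_intros)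
    have d2: "((\<lambda>u. 1 - u ^ 2) has_real_derivative -2 * u) (at u)"
      by (auto intro!: derivative_eq_intros)
    define a where "a = ln (1 - u)"
    define b where "b = ln (1 + u)"
    have "1 - u ^ 2 = (1 - u) * (1 + u)"
      by (simp add: power2_eq_square algebra_simps)
    then have "ln (1 - u ^ 2) = a + b"
      using u by (simp add: ln_mult a_def b_def)
    then have eqs12:
      "ln (1 - u) ^ 2 / 2 / (1 - (1 - u)) * - 1 = - (a ^ 2 / (2 * u))"
      "ln (1 - u ^ 2) ^ 2 / 2 / (1 - (1 - u ^ 2)) * (- 2 * u) = - ((a + b) ^ 2 / u)"
      using u by (simp_all add: power2_eq_square divide_simps flip: a_def)
    have w_eqs: "ln w = a - b" "1 - w = 2 * u / (1 + u)" "1 + w = 2 / (1 + u)"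
      using u by (auto simp: ln_div w_def a_def b_def field_simps)
    have eqs34:
      "ln w ^ 2 / 2 / (1 - w) * (- 2 / (1 + u) ^ 2) = - ((a - b) ^ 2 / (2 * u * (1 + u)))"
      "- 1 * ln w ^ 2 / 2 / (1 + w) * (- 2 / (1 + u) ^ 2) = (a - b) ^ 2 / (2 * (1 + u))"
      unfolding w_eqs using u by (simp_all add: power2_eq_square divide_simps)
    have D':
      "((\<lambda>u. \<Phi> 1 (1 - u)) has_real_derivative - (a ^ 2 / (2 * u))) (at u)"
      "((\<lambda>u. \<Phi> 1 (1 - u ^ 2)) has_real_derivative - ((a + b) ^ 2 / u)) (at u)"
      "((\<lambda>u. \<Phi> 1 ((1 - u) / (1 + u))) has_real_derivative - ((a - b) ^ 2 / (2 * u * (1 + u)))) (at u)"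
      "((\<lambda>u. \<Phi> (-1) ((1 - u) / (1 + u))) has_real_derivative (a - b) ^ 2 / (2 * (1 + u))) (at u)"
      using D[OF d1, of 1] D[OF d2, of 1] D[OF dw, folded w_def, of 1] D[OF dw, folded w_def, of "-1"] u w sq
      unfolding eqs12[symmetric] eqs34[symmetric] by simp_all
    have "(ln_power_primitive 2 has_real_derivative b ^ 2 / u) (at u)"
      unfolding b_def using u by (intro ln_power_primitive_has_real_derivative) auto
    with D' have "(F has_real_derivative - 4 * - (a ^ 2 / (2 * u)) + 2 * (b ^ 2 / u) + - ((a + b) ^ 2 / u)
        + 2 * - ((a - b) ^ 2 / (2 * u * (1 + u))) - 2 * ((a - b) ^ 2 / (2 * (1 + u)))) (at u)"
      unfolding F_def by (intro DERIV_add DERIV_diff DERIV_cmult)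
    also have "- 4 * - (a ^ 2 / (2 * u)) + 2 * (b ^ 2 / u) + - ((a + b) ^ 2 / u)
        + 2 * - ((a - b) ^ 2 / (2 * u * (1 + u))) - 2 * ((a - b) ^ 2 / (2 * (1 + u))) = 0"
      using u by (simp add: divide_simps) (simp add: power2_eq_square algebra_simps)
    finally show "(F has_real_derivative 0) (at u)" .
  qed simp
  \<comment> \<open>At \<open>u = 0\<close> every argument of \<open>\<Phi>\<close> in
    \<open>F\<close> is 1, at \<open>u = 1\<close> every one is 0. So \<open>F 1 = F 0\<close>
    expresses the integral by \<open>rzeta 3\<close> alone, without polylogarithms at
    \<open>1/2\<close>.\<close>
  moreover have "\<Phi> 1 1 = rzeta 3" "\<Phi> (-1) 1 = - 3 / 4 * rzeta 3" "\<Phi> s 0 = 0" for s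
    using polylog_minus_one[of 3] by (simp_all add: \<Phi>_def polylog_primitive_one polylog_one_right)
  ultimately have "ln_power_primitive 2 1 - ln_power_primitive 2 0 = rzeta 3 / 4"
    by (simp add: F_def ln_power_primitive_def flip: \<Phi>_def)
  then show ?thesis
    by (metis has_integral_ln_power_over_primitive one_le_numeral)
qed

subsection \<open>Moments of powers of ln (1 + u)\<close>

text \<open>This is \<open>(-1)^n n\<close> times the integral of
  \<open>u^(n - 1) ln (1 + u)^p\<close> over \<open>[0, 1]\<close>. The normalisation removes the
  signs from the recursion, whose sum then has the form of a truncated star sum with leading entry
  1.\<close>

primrec ln_moment :: "nat \<Rightarrow> nat \<Rightarrow> real" where
  "ln_moment 0 n = (-1) ^ n"
| "ln_moment (Suc p) n =
     ((-1) ^ n - 1) * ln 2 ^ Suc p - real (Suc p) * (\<Sum>k=1..n. ln_moment p k / real k)"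

lemma has_integral_ln_moment:
  assumes "1 \<le> n"
  shows "((\<lambda>u. u ^ (n - 1) * ln (1 + u) ^ p) has_integral (-1) ^ n * ln_moment p n / real n) {0..1}"
  using assms
proof (induction p arbitrary: n)
  case 0
  have "((\<lambda>u. u ^ (n - 1)) has_integral (1 ^ n / real n - 0 ^ n / real n)) {0..1::real}"
    by (rule fundamental_theorem_of_calculus_interior)
      (use 0 in \<open>auto intro!: continuous_intros derivative_eq_intros
        simp flip: has_real_derivative_iff_has_vector_derivative\<close>)
  then show ?case
    using 0 by (simp add: zero_power flip: power_mult_distrib)
next
  case (Suc p)
  \<comment> \<open>Integration by parts, with the antiderivative of \<open>u^(n - 1)\<close> that
    vanishes at \<open>u = -1\<close>: it is divisible by \<open>1 + u\<close>, the denominator of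
    the derivative of the logarithm, and the quotient is the polynomial in \<open>S\<close>.\<close>
  define G where "G = (\<lambda>u. (u ^ n - (-1) ^ n) / real n * ln (1 + u) ^ Suc p)"
  define S where "S = (\<lambda>u::real. \<Sum>k=1..n. (-1) ^ (n - k) * (u ^ (k - 1) * ln (1 + u) ^ p))"
  have D: "((\<lambda>u. u ^ (n - 1) * ln (1 + u) ^ Suc p + real (Suc p) / real n * S u) has_integral (G 1 - G 0)) {0..1}"
  proof (rule fundamental_theorem_of_calculus_interior)
    show "continuous_on {0..1} G"
      unfolding G_def by (intro continuous_intros) (use Suc.prems in auto)
    fix u :: real
    assume u: "u \<in> {0<..<1}"
    have "((\<lambda>u. ln (1 + u)) has_real_derivative 1 / (1 + u)) (at u)"
      using u by (auto intro!: derivative_eq_intros)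
    from DERIV_power[OF this, of "Suc p"]
    have D1: "((\<lambda>u. ln (1 + u) ^ Suc p) has_real_derivative real (Suc p) * (ln (1 + u) ^ p / (1 + u))) (at u)"
      by simp
    have D2: "((\<lambda>u. (u ^ n - (-1) ^ n) / real n) has_real_derivative u ^ (n - 1)) (at u)"
      using Suc.prems by (auto intro!: derivative_eq_intros)
    have "u ^ n - (-1) ^ n = (1 + u) * (\<Sum>k=1..n. (-1) ^ (n - k) * u ^ (k - 1))"
      using power_diff_sumr2[of u n "-1"] by (simp add: sum.atLeast1_atMost_eq add_ac)
    moreover have "S u = (\<Sum>k=1..n. (-1) ^ (n - k) * u ^ (k - 1)) * ln (1 + u) ^ p"
      unfolding S_def sum_distrib_right by (simp only: mult.assoc)
    ultimately have "(u ^ n - (-1) ^ n) / real n * (real (Suc p) * (ln (1 + u) ^ p / (1 + u))) =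
        real (Suc p) / real n * S u"
      using u by simp
    with DERIV_mult[OF D2 D1]
    show "(G has_vector_derivative u ^ (n - 1) * ln (1 + u) ^ Suc p + real (Suc p) / real n * S u) (at u)"
      unfolding G_def by (simp add: mult_ac flip: has_real_derivative_iff_has_vector_derivative)
  qed simp
  have I: "((\<lambda>u. real (Suc p) / real n * S u) has_integral
      real (Suc p) / real n * (\<Sum>k=1..n. (-1) ^ (n - k) * ((-1) ^ k * ln_moment p k / real k))) {0..1}"
    unfolding S_def by (intro has_integral_mult_right has_integral_sum Suc.IH) auto
  have sum_eq: "(\<Sum>k=1..n. (-1) ^ (n - k) * ((-1) ^ k * ln_moment p k / real k)) =
      (-1) ^ n * (\<Sum>k=1..n. ln_moment p k / real k)"
  proof -
    have "(-1) ^ (n - k) * ((-1) ^ k * ln_moment p k / real k) = (-1) ^ n * (ln_moment p k / real k)"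
      if "k \<in> {1..n}" for k
    proof -
      have "(-1::real) ^ (n - k) * (-1) ^ k = (-1) ^ n"
        using that by (simp flip: power_add)
      then show ?thesis
        by (metis mult.assoc times_divide_eq_right)
    qed
    then show ?thesis
      unfolding sum_distrib_left by (rule sum.cong[OF refl])
  qed
  have "((\<lambda>u. u ^ (n - 1) * ln (1 + u) ^ Suc p) has_integral
      (G 1 - G 0 - real (Suc p) / real n * ((-1) ^ n * (\<Sum>k=1..n. ln_moment p k / real k)))) {0..1}"
    using has_integral_diff[OF D I] unfolding sum_eq by simp
  also have "G 1 - G 0 - real (Suc p) / real n * ((-1) ^ n * (\<Sum>k=1..n. ln_moment p k / real k)) =
      (-1) ^ n * ln_moment (Suc p) n / real n"
  proof -
    define x :: real where "x = (-1) ^ n"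
    \<comment> \<open>Because \<open>x * x = 1\<close>; this extracts the sign of the
      normalisation.\<close>
    have x: "1 - x = x * (x - 1)"
      by (simp add: x_def right_diff_distrib flip: power_mult_distrib)
    have G: "G 1 - G 0 = (1 - x) / real n * ln 2 ^ Suc p"
      by (simp add: G_def x_def)
    show ?thesis
      unfolding G x ln_moment.simps x_def[symmetric]
      by (simp add: diff_divide_distrib left_diff_distrib right_diff_distrib mult_ac del: of_nat_Suc power_Suc)
  qed
  finally show ?case .
qed

text \<open>The remainder \<open>e\<close> has derivative \<open>(- t)^N / (1 + t)\<close>, which
  lies between \<open>- t^N\<close> and \<open>t^N\<close>. Monotonicity of \<open>g - e\<close> and
  \<open>g + e\<close> then gives a bound that stays uniform up to \<open>u = 1\<close>.\<close>

lemma ln_one_plus_series_remainder: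
  fixes u :: real
  assumes "0 \<le> u" "u \<le> 1"
  shows "\<bar>ln (1 + u) + (\<Sum>n=1..N. (- u) ^ n / real n)\<bar> \<le> 1 / real (Suc N)"
proof -
  define e where "e = (\<lambda>t::real. ln (1 + t) + (\<Sum>i<N. (- t) ^ Suc i / real (Suc i)))"
  define g where "g = (\<lambda>t::real. t ^ Suc N / real (Suc N))"
  have e: "(e has_real_derivative (- t) ^ N / (1 + t)) (at t)" if "0 \<le> t" for t
  proof -
    have D: "((\<lambda>t. (- t) ^ Suc i / real (Suc i)) has_real_derivative - ((- t) ^ i)) (at t)" for i
    proof -
      have "((\<lambda>t. - t) has_real_derivative - 1) (at t)"
        by (auto intro!: derivative_eq_intros)
      from DERIV_cdivide[OF DERIV_power[OF this, of "Suc i"], of "real (Suc i)"] show ?thesis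
        by (simp del: of_nat_Suc power_Suc)
    qed
    have "((\<lambda>t. ln (1 + t)) has_real_derivative 1 / (1 + t)) (at t)"
      using that by (auto intro!: derivative_eq_intros)
    then have "(e has_real_derivative 1 / (1 + t) + (\<Sum>i<N. - ((- t) ^ i))) (at t)"
      unfolding e_def by (intro DERIV_add DERIV_sum D)
    also have "(\<Sum>i<N. - ((- t) ^ i)) = - ((1 - (- t) ^ N) / (1 + t))"
      using that by (simp add: sum_negf sum_gp_strict)
    also have "1 / (1 + t) + - ((1 - (- t) ^ N) / (1 + t)) = (- t) ^ N / (1 + t)"
      by (simp add: diff_divide_distrib)
    finally show ?thesis .
  qed
  have g: "(g has_real_derivative t ^ N) (at t)" for t
    unfolding g_def using DERIV_cdivide[OF DERIV_power[OF DERIV_ident, of "Suc N"], of "real (Suc N)"]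
    by (simp del: of_nat_Suc power_Suc)
  have bound: "(- t) ^ N / (1 + t) \<le> t ^ N" "- (t ^ N) \<le> (- t) ^ N / (1 + t)" if "0 \<le> t" for t :: real
  proof -
    have "\<bar>(- t) ^ N / (1 + t)\<bar> \<le> t ^ N"
      using that by (simp add: power_abs divide_le_eq mult_le_cancel_left1 abs_divide)
    then show "(- t) ^ N / (1 + t) \<le> t ^ N" "- (t ^ N) \<le> (- t) ^ N / (1 + t)"
      by linarith+
  qed
  have "g 0 - e 0 \<le> g u - e u"
  proof (rule DERIV_nonneg_imp_nondecreasing[OF assms(1)])
    fix t :: real
    assume "0 \<le> t"
    then show "\<exists>y. ((\<lambda>t. g t - e t) has_real_derivative y) (at t) \<and> 0 \<le> y"
      using bound[of t] by (intro exI[of _ "t ^ N - (- t) ^ N / (1 + t)"] conjI DERIV_diff g e) auto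
  qed
  moreover have "g 0 + e 0 \<le> g u + e u"
  proof (rule DERIV_nonneg_imp_nondecreasing[OF assms(1)])
    fix t :: real
    assume "0 \<le> t"
    then show "\<exists>y. ((\<lambda>t. g t + e t) has_real_derivative y) (at t) \<and> 0 \<le> y"
      using bound[of t] by (intro exI[of _ "t ^ N + (- t) ^ N / (1 + t)"] conjI DERIV_add g e) auto
  qed
  moreover have "g 0 = 0" "e 0 = 0"
    by (simp_all add: g_def e_def)
  moreover have "g u \<le> 1 / real (Suc N)"
    unfolding g_def using assms by (intro divide_right_mono power_le_one) auto
  ultimately show ?thesis
    by (simp add: e_def sum.atLeast1_atMost_eq)
qed

text \<open>Each summand is \<open>(-1)^n / n\<close> times a moment integral, so a partial sum
  integrates \<open>ln (1 + u)^p / u\<close> against the truncated series of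
  \<open>- ln (1 + u)\<close>. The first factor is at most 1 as \<open>p\<close> is at least 1, so
  the error is at most \<open>1 / (N + 1)\<close>.\<close>

lemma ln_moment_series_tendsto:
  assumes "1 \<le> p" and I: "((\<lambda>u. ln (1 + u) ^ Suc p / u) has_integral I) {0..1}"
  shows "(\<lambda>N. \<Sum>n=1..N. ln_moment p n / real n ^ 2) \<longlonglongrightarrow> - I"
proof -
  have "\<bar>I + (\<Sum>n=1..N. ln_moment p n / real n ^ 2)\<bar> \<le> 1 / real (Suc N)" for N
  proof -
    define h where "h = (\<lambda>u::real. \<Sum>n=1..N. (-1) ^ n / real n * (u ^ (n - 1) * ln (1 + u) ^ p))"
    have "(h has_integral (\<Sum>n=1..N. (-1) ^ n / real n * ((-1) ^ n * ln_moment p n / real n))) {0..1}"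
      unfolding h_def by (intro has_integral_sum has_integral_mult_right has_integral_ln_moment) auto
    also have "(\<Sum>n=1..N. (-1) ^ n / real n * ((-1) ^ n * ln_moment p n / real n)) =
        (\<Sum>n=1..N. ln_moment p n / real n ^ 2)"
      by (intro sum.cong) (auto simp: power2_eq_square simp flip: power_mult_distrib mult.assoc)
    finally have "((\<lambda>u. ln (1 + u) ^ Suc p / u + h u) has_integral
        (I + (\<Sum>n=1..N. ln_moment p n / real n ^ 2))) (cbox 0 1)"
      using has_integral_add[OF I] by simp
    moreover have "norm (ln (1 + u) ^ Suc p / u + h u) \<le> 1 / real (Suc N)" if "u \<in> cbox 0 1" for u
    \<comment> \<open>At \<open>u = 0\<close> the quotient is 0 by convention, and
      \<open>h 0 = 0\<close> because \<open>ln 1 = 0\<close> and \<open>p\<close> is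
      positive.\<close>
    proof (cases "u = 0")
      case True
      then show ?thesis
        using assms(1) by (simp add: h_def zero_power)
    next
      case False
      with that have u: "0 < u" "u \<le> 1"
        by auto
      have "h u = ln (1 + u) ^ p / u * (\<Sum>n=1..N. (- u) ^ n / real n)"
        unfolding h_def sum_distrib_left
      proof (intro sum.cong)
        fix n assume "n \<in> {1..N}"
        then obtain k where "n = Suc k"
          by (cases n) auto
        then show "(-1) ^ n / real n * (u ^ (n - 1) * ln (1 + u) ^ p) =
            ln (1 + u) ^ p / u * ((- u) ^ n / real n)"
          using u by (simp add: power_minus[of u] mult_ac del: of_nat_Suc)
      qed simp
      then have eq: "ln (1 + u) ^ Suc p / u + h u =
          ln (1 + u) ^ p / u * (ln (1 + u) + (\<Sum>n=1..N. (- u) ^ n / real n))"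
        by (simp add: algebra_simps)
      have ln: "0 \<le> ln (1 + u)" "ln (1 + u) \<le> u"
        using u by (auto intro: ln_add_one_self_le_self)
      then have "ln (1 + u) ^ p \<le> u ^ p"
        by (intro power_mono)
      also have "u ^ p \<le> u ^ 1"
        using u assms(1) by (intro power_decreasing) auto
      finally have "\<bar>ln (1 + u) ^ p / u\<bar> \<le> 1"
        using u ln by simp
      then have "\<bar>ln (1 + u) ^ p / u\<bar> * \<bar>ln (1 + u) + (\<Sum>n=1..N. (- u) ^ n / real n)\<bar> \<le> 1 * (1 / real (Suc N))"
        using u by (intro mult_mono ln_one_plus_series_remainder) auto
      then show ?thesis
        unfolding eq real_norm_def abs_mult by simp
    qed
    ultimately have "norm (I + (\<Sum>n=1..N. ln_moment p n / real n ^ 2)) \<le> 1 / real (Suc N) * measure lborel (cbox 0 (1::real))"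
      by (intro has_integral_bound) auto
    then show ?thesis
      by simp
  qed
  then have "(\<lambda>N. I + (\<Sum>n=1..N. ln_moment p n / real n ^ 2)) \<longlonglongrightarrow> 0"
    by (intro Lim_null_comparison[OF _ LIMSEQ_Suc[OF lim_1_over_n]]) (auto simp: o_def)
  from tendsto_add[OF tendsto_const[of "- I"] this] show ?thesis
    by simp
qed

subsection \<open>Truncated star sums\<close>

text \<open>A nonzero entry contributes at most \<open>1 / k\<close>, and harmonic numbers increase,
  so each entry costs one harmonic factor.\<close>

lemma abs_mzs_trunc_le:
  assumes "0 \<notin> set ss"
  shows "\<bar>mzs_trunc ss n\<bar> \<le> harm n ^ length ss"
  using assms
proof (induction ss arbitrary: n)
  case (Cons s ss)
  have "\<bar>mzs_trunc (s # ss) n\<bar> \<le>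
      (\<Sum>k=1..n. \<bar>(if s > 0 then 1 else -1) ^ k / real k ^ nat \<bar>s\<bar> * mzs_trunc ss k\<bar>)"
    unfolding mzs_trunc.simps by (rule sum_abs)
  also have "\<dots> \<le> (\<Sum>k=1..n. inverse (real k) * harm n ^ length ss)"
  proof (rule sum_mono)
    fix k assume k: "k \<in> {1..n}"
    have "real k ^ 1 \<le> real k ^ nat \<bar>s\<bar>"
      using k Cons.prems by (intro power_increasing) auto
    then have "1 / real k ^ nat \<bar>s\<bar> \<le> inverse (real k)"
      using k by (simp add: inverse_eq_divide frac_le)
    moreover have "\<bar>mzs_trunc ss k\<bar> \<le> harm k ^ length ss"
      using Cons by auto
    moreover have "harm k ^ length ss \<le> (harm n ^ length ss :: real)"
      using k by (intro power_mono harm_mono harm_nonneg) auto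
    ultimately have "1 / real k ^ nat \<bar>s\<bar> * \<bar>mzs_trunc ss k\<bar> \<le> inverse (real k) * harm n ^ length ss"
      by (intro mult_mono) auto
    moreover have "\<bar>(if s > 0 then 1 else -1) ^ k\<bar> = (1 :: real)"
      by (simp add: power_abs)
    ultimately show "\<bar>(if s > 0 then 1 else -1) ^ k / real k ^ nat \<bar>s\<bar> * mzs_trunc ss k\<bar> \<le>
        inverse (real k) * harm n ^ length ss"
      unfolding abs_mult abs_divide by (metis abs_of_nat power_abs)
  qed
  also have "\<dots> = harm n ^ length (s # ss)"
    by (simp add: harm_def sum_distrib_right)
  finally show ?case .
qed simp

lemma harm_power_le_sqrt:
  assumes "1 \<le> n"
  shows "harm n ^ k \<le> 2 ^ k * fact k * exp (1 / 2) * sqrt (real n)"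
proof -
  \<comment> \<open>Halving \<open>1 + ln n\<close> makes \<open>exp x\<close> a multiple of
    \<open>sqrt n\<close>; divided by \<open>n^2\<close> this leaves the summable exponent
    \<open>-3/2\<close>.\<close>
  define x where "x = (1 + ln (real n)) / 2"
  have "harm n \<le> 1 + ln (real n)"
    using euler_mascheroni_sequence_decreasing[of 1 n] assms by (simp add: harm_def)
  then have "harm n ^ k \<le> (2 * x) ^ k"
    by (intro power_mono) (auto simp: x_def harm_nonneg)
  also have "\<dots> \<le> 2 ^ k * (fact k * exp x)"
    unfolding power_mult_distrib
    using assms by (intro mult_left_mono power_le_fact_mult_exp) (auto simp: x_def)
  also have "exp x = exp (1 / 2) * sqrt (real n)"
    using assms by (simp add: x_def add_divide_distrib exp_add flip: ln_sqrt)
  finally show ?thesis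
    by (simp add: mult_ac)
qed

text \<open>\<open>zeta_star\<close> is a \<open>lim\<close>, so convergence has to be proved first;
  the leading entry 2 outweighs the powers of harmonic numbers.\<close>

lemma mzs_trunc_two_tendsto:
  assumes "0 \<notin> set ss"
  shows "(\<lambda>N. \<Sum>n=1..N. mzs_trunc ss n / real n ^ 2) \<longlonglongrightarrow> zeta_star (2 # ss)"
proof -
  define C where "C = 2 ^ length ss * fact (length ss) * exp (1 / 2 :: real)"
  have "summable (\<lambda>n. mzs_trunc ss n / real n ^ 2)"
  proof (rule summable_comparison_test')
    show "summable (\<lambda>n. C * real n powr (- (3 / 2)))"
      by (intro summable_mult) (simp add: summable_real_powr_iff)
    fix n :: nat assume n: "1 \<le> n"
    have "\<bar>mzs_trunc ss n\<bar> \<le> C * sqrt (real n)"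
      unfolding C_def using abs_mzs_trunc_le[OF assms, of n] harm_power_le_sqrt[OF n, of "length ss"]
      by linarith
    also have "sqrt (real n) = real n powr (- (3 / 2)) * real n ^ 2"
    proof -
      have "sqrt (real n) = real n powr (- (3 / 2) + 2)"
        by (simp add: powr_half_sqrt)
      also have "\<dots> = real n powr (- (3 / 2)) * real n ^ 2"
        using n by (subst powr_add) simp
      finally show ?thesis .
    qed
    finally show "norm (mzs_trunc ss n / real n ^ 2) \<le> C * real n powr (- (3 / 2))"
      using n by (simp add: divide_le_eq mult_ac)
  qed
  then have "summable (\<lambda>n. mzs_trunc ss (Suc n) / real (Suc n) ^ 2)"
    by (subst summable_Suc_iff)
  then have "convergent (\<lambda>N. \<Sum>n<N. mzs_trunc ss (Suc n) / real (Suc n) ^ 2)"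
    by (simp add: summable_iff_convergent)
  moreover have "(\<Sum>n<N. mzs_trunc ss (Suc n) / real (Suc n) ^ 2) = mzs_trunc (2 # ss) N" for N
    by (simp add: sum.atLeast1_atMost_eq)
  moreover have "(\<Sum>n=1..N. mzs_trunc ss n / real n ^ 2) = mzs_trunc (2 # ss) N" for N
    by simp
  ultimately show ?thesis
    unfolding zeta_star_def by (simp only: convergent_LIMSEQ_iff)
qed

text \<open>Bookkeeping for the shape of \<open>ln_moment_Suc\<close>, applied with
  \<open>d n = n\<close> to prepend an entry 1 and with \<open>d n = n^2\<close> to prepend the
  entry 2.\<close>

lemma sum_divide_linear_combination:
  fixes d :: "nat \<Rightarrow> real"
  shows "(\<Sum>n\<in>B. (x n * a + (\<Sum>i\<in>A. c i * (y i n - z i n)) + b * t n) / d n) =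
    (\<Sum>n\<in>B. x n / d n) * a
    + (\<Sum>i\<in>A. c i * ((\<Sum>n\<in>B. y i n / d n) - (\<Sum>n\<in>B. z i n / d n)))
    + b * (\<Sum>n\<in>B. t n / d n)"
proof -
  have "(\<Sum>n\<in>B. (\<Sum>i\<in>A. c i * (y i n - z i n)) / d n) =
      (\<Sum>i\<in>A. \<Sum>n\<in>B. c i * (y i n / d n - z i n / d n))"
    unfolding sum_divide_distrib
    by (subst sum.swap) (simp only: diff_divide_distrib times_divide_eq_right[symmetric])
  also have "\<dots> = (\<Sum>i\<in>A. c i * ((\<Sum>n\<in>B. y i n / d n) - (\<Sum>n\<in>B. z i n / d n)))"
    by (simp only: sum_subtractf sum_distrib_left[symmetric])
  finally show ?thesis
    by (simp add: add_divide_distrib sum.distrib sum_distrib_left sum_distrib_right)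
qed

text \<open>The unrolled recursion. In \<open>(-1)^k - 1\<close> the sign starts the sums ending in
  \<open>-1\<close>, the constant those with entries 1 only. The last term has no partner because
  \<open>ln_moment 0\<close> is a pure sign.\<close>

lemma ln_moment_Suc:
  "ln_moment (Suc p) n = ((-1) ^ n - 1) * ln 2 ^ Suc p
    + (\<Sum>i=1..p. (-1) ^ i * fact i * real (Suc p choose i) * ln 2 ^ (Suc p - i)
        * (mzs_trunc (replicate (i - 1) 1 @ [-1]) n - mzs_trunc (replicate i 1) n))
    + (-1) ^ Suc p * fact (Suc p) * mzs_trunc (replicate p 1 @ [-1]) n"
proof (induction p arbitrary: n)
  case 0
  show ?case
    by simp
next
  case (Suc p)
  define T where "T = (\<lambda>i. mzs_trunc (replicate i 1 @ [-1]))"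
  define U where "U = (\<lambda>i. mzs_trunc (replicate i 1))"
  define c where "c = (\<lambda>p i. (-1) ^ i * fact i * real (p choose i) * ln 2 ^ (p - i) :: real)"
  have T: "(\<Sum>k=1..n. T i k / real k) = T (Suc i) n" for i
    by (simp add: T_def)
  have U: "(\<Sum>k=1..n. U i k / real k) = U (Suc i) n" for i
    by (simp add: U_def)
  have TU: "(\<Sum>k=1..n. ((-1) ^ k - 1) / real k) = T 0 n - U 1 n"
    by (simp add: T_def U_def diff_divide_distrib sum_subtractf)
  \<comment> \<open>The absorption identity for binomials turns the recursion's factor
    \<open>- (p + 2)\<close> into an index shift.\<close>
  have c: "c (Suc (Suc p)) (Suc i) = - real (Suc (Suc p)) * c (Suc p) i" for i
  proof -
    have "real (Suc i) * real (Suc (Suc p) choose Suc i) = real (Suc (Suc p)) * real (Suc p choose i)"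
      by (simp only: Suc_times_binomial flip: of_nat_mult)
    then show ?thesis
      unfolding c_def by (simp add: mult_ac del: of_nat_Suc binomial_Suc_Suc)
  qed
  have IH: "ln_moment (Suc p) k = ((-1) ^ k - 1) * ln 2 ^ Suc p
      + (\<Sum>i=1..p. c (Suc p) i * (T (i - 1) k - U i k)) + c (Suc p) (Suc p) * T p k" for k
    unfolding Suc.IH by (simp add: c_def T_def U_def)
  have "(\<Sum>k=1..n. ln_moment (Suc p) k / real k) = (T 0 n - U 1 n) * ln 2 ^ Suc p
      + (\<Sum>i=1..p. c (Suc p) i * (T (Suc (i - 1)) n - U (Suc i) n)) + c (Suc p) (Suc p) * T (Suc p) n"
    unfolding IH sum_divide_linear_combination T U TU ..
  then have "ln_moment (Suc (Suc p)) n = ((-1) ^ n - 1) * ln 2 ^ Suc (Suc p)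
      - real (Suc (Suc p)) * (c (Suc p) 0 * (T 0 n - U 1 n)
      + (\<Sum>i=1..p. c (Suc p) i * (T i n - U (Suc i) n)) + c (Suc p) (Suc p) * T (Suc p) n)"
    unfolding ln_moment.simps(2)[of "Suc p"] by (simp add: c_def mult.commute)
  \<comment> \<open>The boundary term is the missing summand \<open>i = 0\<close>, so the shifted
    sum covers \<open>1..Suc p\<close>.\<close>
  also have "c (Suc p) 0 * (T 0 n - U 1 n) + (\<Sum>i=1..p. c (Suc p) i * (T i n - U (Suc i) n)) =
      (\<Sum>i<Suc p. c (Suc p) i * (T i n - U (Suc i) n))"
    by (simp add: sum.lessThan_Suc_shift sum.atLeast1_atMost_eq del: sum.lessThan_Suc)
  also have "((-1) ^ n - 1) * ln 2 ^ Suc (Suc p) - real (Suc (Suc p)) *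
        ((\<Sum>i<Suc p. c (Suc p) i * (T i n - U (Suc i) n)) + c (Suc p) (Suc p) * T (Suc p) n) =
      ((-1) ^ n - 1) * ln 2 ^ Suc (Suc p)
      + (\<Sum>i<Suc p. c (Suc (Suc p)) (Suc i) * (T i n - U (Suc i) n)) + c (Suc (Suc p)) (Suc (Suc p)) * T (Suc p) n"
    unfolding c by (simp add: algebra_simps sum_distrib_left sum_subtractf sum.distrib sum_negf del: sum.lessThan_Suc)
  also have "(\<Sum>i<Suc p. c (Suc (Suc p)) (Suc i) * (T i n - U (Suc i) n)) =
      (\<Sum>i=1..Suc p. c (Suc (Suc p)) i * (T (i - 1) n - U i n))"
    by (simp add: sum.atLeast1_atMost_eq del: sum.lessThan_Suc sum.cl_ivl_Suc)
  also have "c (Suc (Suc p)) (Suc (Suc p)) = (-1) ^ Suc (Suc p) * fact (Suc (Suc p))"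
    by (simp add: c_def)
  finally show ?case
    unfolding c_def T_def U_def .
qed

text \<open>Both sides are limits of the same sums of \<open>ln_moment (Suc p) n / n^2\<close>: once
  through the integral, once through \<open>ln_moment_Suc\<close>.\<close>

lemma zeta_star_relation:
  assumes I: "((\<lambda>u. ln (1 + u) ^ Suc (Suc p) / u) has_integral I) {0..1}"
  shows "- I = - (3 / 2) * rzeta 2 * ln 2 ^ Suc p
    + (\<Sum>i=1..p. (-1) ^ i * fact i * real (Suc p choose i) * ln 2 ^ (Suc p - i)
        * (zeta_star (2 # replicate (i - 1) 1 @ [-1]) - zeta_star (2 # replicate i 1)))
    + (-1) ^ Suc p * fact (Suc p) * zeta_star (2 # replicate p 1 @ [-1])"
proof (rule LIMSEQ_unique)
  show "(\<lambda>N. \<Sum>n=1..N. ln_moment (Suc p) n / real n ^ 2) \<longlonglongrightarrow> - I"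
    by (intro ln_moment_series_tendsto I) simp
  \<comment> \<open>The alternating value at 2 is \<open>- rzeta 2 / 2\<close>; subtracting
    \<open>rzeta 2\<close> explains the coefficient \<open>-3/2\<close>.\<close>
  have "(\<lambda>N. \<Sum>n<N. ((-1) ^ Suc n / real (Suc n) ^ 2 - 1 / real (Suc n) ^ 2))
      \<longlonglongrightarrow> (2 / 2 ^ 2 - 1) * rzeta 2 - rzeta 2"
    using sums_diff[OF sums_alternating_zeta[of 2] sums_rzeta[of 2]] by (simp add: sums_def)
  then have Z: "(\<lambda>N. \<Sum>n=1..N. ((-1) ^ n - 1) / real n ^ 2) \<longlonglongrightarrow> - (3 / 2) * rzeta 2"
    by (simp add: diff_divide_distrib sum.atLeast1_atMost_eq)
  define T where "T = (\<lambda>i. mzs_trunc (replicate i 1 @ [-1]))"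
  define U where "U = (\<lambda>i. mzs_trunc (replicate i 1))"
  define c where "c = (\<lambda>i. (-1) ^ i * fact i * real (Suc p choose i) * ln 2 ^ (Suc p - i) :: real)"
  have T: "(\<lambda>N. \<Sum>n=1..N. T i n / real n ^ 2) \<longlonglongrightarrow> zeta_star (2 # replicate i 1 @ [-1])" for i
    unfolding T_def by (rule mzs_trunc_two_tendsto) auto
  have U: "(\<lambda>N. \<Sum>n=1..N. U i n / real n ^ 2) \<longlonglongrightarrow> zeta_star (2 # replicate i 1)" for i
    unfolding U_def by (rule mzs_trunc_two_tendsto) auto
  have "(\<Sum>n=1..N. ln_moment (Suc p) n / real n ^ 2) =
      (\<Sum>n=1..N. ((-1) ^ n - 1) / real n ^ 2) * ln 2 ^ Suc p
      + (\<Sum>i=1..p. c i * ((\<Sum>n=1..N. T (i - 1) n / real n ^ 2) - (\<Sum>n=1..N. U i n / real n ^ 2)))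
      + (-1) ^ Suc p * fact (Suc p) * (\<Sum>n=1..N. T p n / real n ^ 2)" for N
    unfolding T_def U_def c_def ln_moment_Suc sum_divide_linear_combination ..
  moreover have "(\<lambda>N. (\<Sum>n=1..N. ((-1) ^ n - 1) / real n ^ 2) * ln 2 ^ Suc p
      + (\<Sum>i=1..p. c i * ((\<Sum>n=1..N. T (i - 1) n / real n ^ 2) - (\<Sum>n=1..N. U i n / real n ^ 2)))
      + (-1) ^ Suc p * fact (Suc p) * (\<Sum>n=1..N. T p n / real n ^ 2)) \<longlonglongrightarrow>
    - (3 / 2) * rzeta 2 * ln 2 ^ Suc p
    + (\<Sum>i=1..p. c i * (zeta_star (2 # replicate (i - 1) 1 @ [-1]) - zeta_star (2 # replicate i 1)))
    + (-1) ^ Suc p * fact (Suc p) * zeta_star (2 # replicate p 1 @ [-1])"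
    by (rule tendsto_add[OF tendsto_add[OF tendsto_mult_right[OF Z]
          tendsto_sum[OF tendsto_mult_left[OF tendsto_diff[OF T U]]]] tendsto_mult_left[OF T]])
  ultimately show "(\<lambda>N. \<Sum>n=1..N. ln_moment (Suc p) n / real n ^ 2) \<longlonglongrightarrow>
    - (3 / 2) * rzeta 2 * ln 2 ^ Suc p
    + (\<Sum>i=1..p. (-1) ^ i * fact i * real (Suc p choose i) * ln 2 ^ (Suc p - i)
        * (zeta_star (2 # replicate (i - 1) 1 @ [-1]) - zeta_star (2 # replicate i 1)))
    + (-1) ^ Suc p * fact (Suc p) * zeta_star (2 # replicate p 1 @ [-1])"
    unfolding c_def by presburger
qed

section \<open>Solving the relation for the zeta star value\<close>

theorem theorem2p6:
  fixes m :: nat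
  assumes "m \<ge> 1"
  shows "zeta_star [2, -1] = rzeta 3 / 4 - 3 / 2 * rzeta 2 * ln 2
    \<and> zeta_star (2 # replicate m 1 @ [-1]) =
        (real m + 2) / fact (m + 3) * (-1) ^ m * ln 2 ^ (m + 3)
      + (real m + 2) * (-1) ^ m * (rzeta (m + 3) - polylog (m + 3) (1 / 2))
      - (real m + 2) * (-1) ^ m *
          (\<Sum>j=1..m+2. ln 2 ^ (m + 3 - j) / fact (m + 3 - j) * polylog j (1 / 2))
      - 3 / 2 * (-1) ^ m / fact (m + 1) * rzeta 2 * ln 2 ^ (m + 1)
      - (-1) ^ m / fact (m + 1) *
          (\<Sum>i=1..m. (-1) ^ (i - 1) * fact i * real ((m + 1) choose i) * ln 2 ^ (m + 1 - i)
             * (zeta_star (2 # replicate (i - 1) 1 @ [-1]) - zeta_star (2 # replicate i 1)))"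
proof
  \<comment> \<open>For \<open>p = 0\<close> the sum over \<open>i\<close> in the relation is empty
    and the integral is \<open>rzeta 3 / 4\<close>.\<close>
  show "zeta_star [2, -1] = rzeta 3 / 4 - 3 / 2 * rzeta 2 * ln 2"
    using zeta_star_relation[of 0 "rzeta 3 / 4"] has_integral_ln_square_over
    by (simp add: numeral_2_eq_2)
  define P where "P = (\<Sum>j=1..m+2. ln 2 ^ (m + 3 - j) / fact (m + 3 - j) * polylog j (1 / 2))"
  define S where "S = (\<Sum>i=1..m. (-1) ^ (i - 1) * fact i * real ((m + 1) choose i) * ln 2 ^ (m + 1 - i)
      * (zeta_star (2 # replicate (i - 1) 1 @ [-1]) - zeta_star (2 # replicate i 1)))"
  define Z where "Z = zeta_star (2 # replicate m 1 @ [-1])"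
  define f :: real where "f = fact (m + 1)"
  \<comment> \<open>The primitive sums up to \<open>j = m + 3\<close>; its last term, free of
    logarithms, is the polylogarithm that the theorem pairs with
    \<open>rzeta (m + 3)\<close>.\<close>
  have "polylog_primitive (m + 2) 1 (1 / 2) = P + polylog (m + 3) (1 / 2)"
  proof -
    have "polylog_primitive (m + 2) 1 (1 / 2) =
        (\<Sum>j=1..Suc (m + 2). ln 2 ^ (m + 3 - j) / fact (m + 3 - j) * polylog j (1 / 2))"
      unfolding polylog_primitive_def by (intro sum.cong) (simp_all add: ln_div numeral_3_eq_3)
    then show ?thesis
      by (simp add: P_def numeral_3_eq_3)
  qed
  \<comment> \<open>The theorem has \<open>(-1)^(i - 1)\<close> where the relation has
    \<open>(-1)^i\<close>, hence \<open>- S\<close>.\<close>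
  moreover have "(\<Sum>i=1..m. (-1) ^ i * fact i * real (Suc m choose i) * ln 2 ^ (Suc m - i)
        * (zeta_star (2 # replicate (i - 1) 1 @ [-1]) - zeta_star (2 # replicate i 1))) = - S"
    unfolding S_def sum_negf[symmetric]
  proof (intro sum.cong)
    fix i assume "i \<in> {1..m}"
    then obtain k where "i = Suc k"
      by (cases i) auto
    then show "(-1) ^ i * fact i * real (Suc m choose i) * ln 2 ^ (Suc m - i)
        * (zeta_star (2 # replicate (i - 1) 1 @ [-1]) - zeta_star (2 # replicate i 1)) =
      - ((-1) ^ (i - 1) * fact i * real ((m + 1) choose i) * ln 2 ^ (m + 1 - i)
        * (zeta_star (2 # replicate (i - 1) 1 @ [-1]) - zeta_star (2 # replicate i 1)))"
      by simp
  qed simp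
  moreover have "fact (m + 2) = (real m + 2) * f" "fact (Suc m) = f"
    by (simp_all add: f_def)
  moreover have I: "((\<lambda>u. ln (1 + u) ^ Suc (Suc m) / u) has_integral
      (ln 2 ^ (m + 3) / (real m + 3)
        + fact (m + 2) * (rzeta (m + 3) - polylog_primitive (m + 2) 1 (1 / 2)))) {0..1}"
    using has_integral_ln_power_over[of "m + 2"] by (simp add: numeral_3_eq_3 add_ac)
  ultimately have rel: "- (ln 2 ^ (m + 3) / (real m + 3) + (real m + 2) * f * (rzeta (m + 3) - (P + polylog (m + 3) (1 / 2)))) =
      - (3 / 2) * rzeta 2 * ln 2 ^ (m + 1) + - S + (-1) ^ Suc m * f * Z"
    using zeta_star_relation[OF I] by (simp only: Z_def Suc_eq_plus1)
  define s :: real where "s = (-1) ^ m"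
  have "s * s = 1"
    by (simp add: s_def flip: power_mult_distrib)
  have "f > 0"
    by (simp add: f_def)
  \<comment> \<open>The relation contains \<open>Z\<close> as \<open>- s * f * Z\<close>; the sign
    \<open>s\<close> is its own inverse.\<close>
  have "Z = s * (s * f * Z) / f"
    using \<open>s * s = 1\<close> \<open>f > 0\<close> by (simp flip: mult.assoc)
  also have "s * f * Z = ln 2 ^ (m + 3) / (real m + 3)
      + (real m + 2) * f * (rzeta (m + 3) - (P + polylog (m + 3) (1 / 2)))
      - 3 / 2 * rzeta 2 * ln 2 ^ (m + 1) - S"
    using rel by (simp add: s_def)
  also have "s * \<dots> / f = 1 / ((real m + 3) * f) * s * ln 2 ^ (m + 3)
      + (real m + 2) * s * (rzeta (m + 3) - polylog (m + 3) (1 / 2))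
      - (real m + 2) * s * P - 3 / 2 * s / f * rzeta 2 * ln 2 ^ (m + 1) - s / f * S"
    using \<open>f > 0\<close> by (simp add: divide_simps) (simp add: algebra_simps)
  also have "1 / ((real m + 3) * f) = (real m + 2) / fact (m + 3)"
  proof -
    have "fact (m + 3) = (real m + 3) * ((real m + 2) * f)"
      by (simp add: f_def numeral_3_eq_3 algebra_simps)
    then show ?thesis
      by simp
  qed
  finally show "zeta_star (2 # replicate m 1 @ [-1]) =
        (real m + 2) / fact (m + 3) * (-1) ^ m * ln 2 ^ (m + 3)
      + (real m + 2) * (-1) ^ m * (rzeta (m + 3) - polylog (m + 3) (1 / 2))
      - (real m + 2) * (-1) ^ m *
          (\<Sum>j=1..m+2. ln 2 ^ (m + 3 - j) / fact (m + 3 - j) * polylog j (1 / 2))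
      - 3 / 2 * (-1) ^ m / fact (m + 1) * rzeta 2 * ln 2 ^ (m + 1)
      - (-1) ^ m / fact (m + 1) *
          (\<Sum>i=1..m. (-1) ^ (i - 1) * fact i * real ((m + 1) choose i) * ln 2 ^ (m + 1 - i)
             * (zeta_star (2 # replicate (i - 1) 1 @ [-1]) - zeta_star (2 # replicate i 1)))"
    unfolding P_def S_def Z_def f_def s_def .
qed

end
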